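(* Let $\Omega \subset \mathbb{R}^d$ be open and bounded. Let $T$ be a self-adjoint bounded operator on $L_2(\Omega)$ such that $T L_2(\Omega) \subset C(\overline{\Omega})$. Then $T^3$ has a kernel in $C(\overline{\Omega} \times \overline{\Omega})$; that is, there exists a $K \in C(\overline{\Omega} \times \overline{\Omega})$ such that $$(T^3 u)(x) = \int_\Omega K(x,y)\, u(y)\, dy$$ for all $u \in L_2(\Omega)$ and $x \in \overline{\Omega}$.
   Context: $L_2(\Omega)$ is the complex Hilbert space of (classes of) square-integrable functions on $\Omega$ with Lebesgue measure, and $C(\overline{\Omega})$ is the space of complex-valued continuous functions on $\overline{\Omega}$. The inclusion $T L_2(\Omega) \subset C(\overline{\Omega})$ means that for every $u \in L_2(\Omega)$ the element $Tu$ has a representative on $\Omega$ which extends to a (necessarily unique) continuous function on $\overline{\Omega}$; $Tu$ is identified with this continuous function, so that $(Tu)(x)$ is defined for every $x \in \overline{\Omega}$. The same convention applies to $T^3 u$. *)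

theory Defs
  imports "HOL-Analysis.Analysis"
begin

section \<open>The complex Hilbert space of square-integrable functions\<close>

text \<open>
  Square-integrable functions are represented by total functions, of which only the values
  on \<^term>\<open>\<Omega>\<close> matter: neither measurability nor the almost-everywhere quantifier of
  \<^term>\<open>lebesgue_on \<Omega>\<close> sees the values outside \<^term>\<open>\<Omega>\<close>.
\<close>

definition sq_integrable_on :: "'a::euclidean_space set \<Rightarrow> ('a \<Rightarrow> complex) set" where
  "sq_integrable_on \<Omega> =
     {u. u \<in> borel_measurable (lebesgue_on \<Omega>) \<and>
         integrable (lebesgue_on \<Omega>) (\<lambda>x. (cmod (u x))\<^sup>2)}"

definition ae_rel :: "'a::euclidean_space set \<Rightarrow> (('a \<Rightarrow> complex) \<times> ('a \<Rightarrow> complex)) set" where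
  "ae_rel \<Omega> =
     {(u, v). u \<in> sq_integrable_on \<Omega> \<and> v \<in> sq_integrable_on \<Omega> \<and>
              (AE x in lebesgue_on \<Omega>. u x = v x)}"

type_synonym 'a L2_class = "('a \<Rightarrow> complex) set"

definition L2 :: "'a::euclidean_space set \<Rightarrow> 'a L2_class set" where
  "L2 \<Omega> = sq_integrable_on \<Omega> // ae_rel \<Omega>"

definition L2_class_of :: "'a::euclidean_space set \<Rightarrow> ('a \<Rightarrow> complex) \<Rightarrow> 'a L2_class" where
  "L2_class_of \<Omega> u = ae_rel \<Omega> `` {u}"

text \<open>
  The unions in the next two definitions are over families of identical classes; see
  \<open>L2_add_class_of\<close> and \<open>L2_scale_class_of\<close> below.
\<close>

definition L2_add ::
    "'a::euclidean_space set \<Rightarrow> 'a L2_class \<Rightarrow> 'a L2_class \<Rightarrow> 'a L2_class" where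
  "L2_add \<Omega> f g = (\<Union>u\<in>f. \<Union>v\<in>g. L2_class_of \<Omega> (\<lambda>x. u x + v x))"

definition L2_scale ::
    "'a::euclidean_space set \<Rightarrow> complex \<Rightarrow> 'a L2_class \<Rightarrow> 'a L2_class" where
  "L2_scale \<Omega> c f = (\<Union>u\<in>f. L2_class_of \<Omega> (\<lambda>x. c * u x))"

definition L2_inner ::
    "'a::euclidean_space set \<Rightarrow> 'a L2_class \<Rightarrow> 'a L2_class \<Rightarrow> complex" where
  "L2_inner \<Omega> f g =
     (THE c. \<forall>u\<in>f. \<forall>v\<in>g. c = (LINT x|lebesgue_on \<Omega>. u x * cnj (v x)))"

definition L2_norm :: "'a::euclidean_space set \<Rightarrow> 'a L2_class \<Rightarrow> real" where
  "L2_norm \<Omega> f = sqrt (Re (L2_inner \<Omega> f f))"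


section \<open>Bounded and self-adjoint operators\<close>

definition L2_bounded_operator ::
    "'a::euclidean_space set \<Rightarrow> ('a L2_class \<Rightarrow> 'a L2_class) \<Rightarrow> bool" where
  "L2_bounded_operator \<Omega> T \<longleftrightarrow>
     (\<forall>f\<in>L2 \<Omega>. T f \<in> L2 \<Omega>) \<and>
     (\<forall>f\<in>L2 \<Omega>. \<forall>g\<in>L2 \<Omega>. T (L2_add \<Omega> f g) = L2_add \<Omega> (T f) (T g)) \<and>
     (\<forall>c. \<forall>f\<in>L2 \<Omega>. T (L2_scale \<Omega> c f) = L2_scale \<Omega> c (T f)) \<and>
     (\<exists>B. \<forall>f\<in>L2 \<Omega>. L2_norm \<Omega> (T f) \<le> B * L2_norm \<Omega> f)"

definition L2_self_adjoint ::
    "'a::euclidean_space set \<Rightarrow> ('a L2_class \<Rightarrow> 'a L2_class) \<Rightarrow> bool" where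
  "L2_self_adjoint \<Omega> T \<longleftrightarrow>
     (\<forall>f\<in>L2 \<Omega>. \<forall>g\<in>L2 \<Omega>. L2_inner \<Omega> (T f) g = L2_inner \<Omega> f (T g))"


section \<open>Elements with a continuous representative\<close>

text \<open>
  Since representatives are total functions that may be changed freely outside \<^term>\<open>\<Omega>\<close>,
  a class has a representative on \<^term>\<open>\<Omega>\<close> extending continuously to the closure iff it has
  a member that is continuous on the closure.
\<close>

definition has_continuous_rep :: "'a::euclidean_space set \<Rightarrow> 'a L2_class \<Rightarrow> bool" where
  "has_continuous_rep \<Omega> f \<longleftrightarrow> (\<exists>g\<in>f. continuous_on (closure \<Omega>) g)"

text \<open>
  The value at a point of the closure of the continuous function identified with the class
  \<^term>\<open>f\<close>; it is meaningful for open \<^term>\<open>\<Omega>\<close> and classes with a continuous representative, see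
  \<open>continuous_rep_value_eq\<close> below.
\<close>

definition continuous_rep_value ::
    "'a::euclidean_space set \<Rightarrow> 'a L2_class \<Rightarrow> 'a \<Rightarrow> complex" where
  "continuous_rep_value \<Omega> f x =
     (THE y. \<exists>g\<in>f. continuous_on (closure \<Omega>) g \<and> y = g x)"


section \<open>The definitions do not depend on representatives\<close>

lemma sq_integrable_on_add:
  assumes "u \<in> sq_integrable_on \<Omega>" "v \<in> sq_integrable_on \<Omega>"
  shows "(\<lambda>x. u x + v x) \<in> sq_integrable_on \<Omega>"
proof -
  have "integrable (lebesgue_on \<Omega>) (\<lambda>x. (cmod (u x + v x))\<^sup>2)"
  proof (rule Bochner_Integration.integrable_bound)
    show "integrable (lebesgue_on \<Omega>) (\<lambda>x. 2 * (cmod (u x))\<^sup>2 + 2 * (cmod (v x))\<^sup>2)"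
      using assms by (auto simp: sq_integrable_on_def)
    show "(\<lambda>x. (cmod (u x + v x))\<^sup>2) \<in> borel_measurable (lebesgue_on \<Omega>)"
      using assms by (auto simp: sq_integrable_on_def)
    have "(cmod (a + b))\<^sup>2 \<le> 2 * (cmod a)\<^sup>2 + 2 * (cmod b)\<^sup>2" for a b
    proof -
      have "(cmod (a + b))\<^sup>2 \<le> (cmod a + cmod b)\<^sup>2"
        by (intro power_mono norm_triangle_ineq) auto
      also have "\<dots> \<le> 2 * (cmod a)\<^sup>2 + 2 * (cmod b)\<^sup>2"
        using zero_le_power2[of "cmod a - cmod b"]
        by (simp add: power2_eq_square algebra_simps)
      finally show ?thesis .
    qed
    then show "AE x in lebesgue_on \<Omega>. norm ((cmod (u x + v x))\<^sup>2)
        \<le> norm (2 * (cmod (u x))\<^sup>2 + 2 * (cmod (v x))\<^sup>2)"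
      by (intro AE_I2) (simp add: abs_of_nonneg)
  qed
  then show ?thesis
    using assms by (auto simp: sq_integrable_on_def)
qed

lemma sq_integrable_on_scale:
  "u \<in> sq_integrable_on \<Omega> \<Longrightarrow> (\<lambda>x. c * u x) \<in> sq_integrable_on \<Omega>"
  by (auto simp: sq_integrable_on_def norm_mult power_mult_distrib)

lemma equiv_ae_rel: "equiv (sq_integrable_on \<Omega>) (ae_rel \<Omega>)"
proof (rule equivI)
  show "ae_rel \<Omega> \<subseteq> sq_integrable_on \<Omega> \<times> sq_integrable_on \<Omega>"
    by (auto simp: ae_rel_def)
  show "refl_on (sq_integrable_on \<Omega>) (ae_rel \<Omega>)"
    by (auto simp: refl_on_def ae_rel_def)
  show "sym (ae_rel \<Omega>)"
  proof (rule symI)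
    fix u v
    assume uv: "(u, v) \<in> ae_rel \<Omega>"
    then have "AE x in lebesgue_on \<Omega>. u x = v x" by (simp add: ae_rel_def)
    then have "AE x in lebesgue_on \<Omega>. v x = u x" by eventually_elim simp
    then show "(v, u) \<in> ae_rel \<Omega>" using uv by (simp add: ae_rel_def)
  qed
  show "trans (ae_rel \<Omega>)"
  proof (rule transI)
    fix u v w
    assume uv: "(u, v) \<in> ae_rel \<Omega>" and vw: "(v, w) \<in> ae_rel \<Omega>"
    from uv have "AE x in lebesgue_on \<Omega>. u x = v x" by (simp add: ae_rel_def)
    moreover from vw have "AE x in lebesgue_on \<Omega>. v x = w x" by (simp add: ae_rel_def)
    ultimately have "AE x in lebesgue_on \<Omega>. u x = w x" by eventually_elim simp
    then show "(u, w) \<in> ae_rel \<Omega>" using uv vw by (simp add: ae_rel_def)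
  qed
qed

lemma L2_class_of_in_L2: "u \<in> sq_integrable_on \<Omega> \<Longrightarrow> L2_class_of \<Omega> u \<in> L2 \<Omega>"
  by (simp add: L2_class_of_def L2_def quotientI)

lemma L2_cases:
  assumes "f \<in> L2 \<Omega>"
  obtains u where "u \<in> sq_integrable_on \<Omega>" "f = L2_class_of \<Omega> u"
  using assms by (auto simp: L2_def L2_class_of_def elim!: quotientE)

lemma mem_L2_class_of_iff:
  "v \<in> L2_class_of \<Omega> u \<longleftrightarrow>
     u \<in> sq_integrable_on \<Omega> \<and> v \<in> sq_integrable_on \<Omega> \<and> (AE x in lebesgue_on \<Omega>. u x = v x)"
  by (simp add: L2_class_of_def ae_rel_def)

lemma L2_class_of_eq_iff:
  assumes "u \<in> sq_integrable_on \<Omega>" "v \<in> sq_integrable_on \<Omega>"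
  shows "L2_class_of \<Omega> u = L2_class_of \<Omega> v \<longleftrightarrow> (AE x in lebesgue_on \<Omega>. u x = v x)"
  using eq_equiv_class_iff[OF equiv_ae_rel assms] assms
  by (simp add: L2_class_of_def ae_rel_def)

lemma L2_add_class_of:
  assumes "u \<in> sq_integrable_on \<Omega>" "v \<in> sq_integrable_on \<Omega>"
  shows "L2_add \<Omega> (L2_class_of \<Omega> u) (L2_class_of \<Omega> v) = L2_class_of \<Omega> (\<lambda>x. u x + v x)"
proof -
  have *: "L2_class_of \<Omega> (\<lambda>x. u' x + v' x) = L2_class_of \<Omega> (\<lambda>x. u x + v x)"
    if "u' \<in> L2_class_of \<Omega> u" "v' \<in> L2_class_of \<Omega> v" for u' v'
  proof -
    have "AE x in lebesgue_on \<Omega>. u x = u' x" "AE x in lebesgue_on \<Omega>. v x = v' x"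
      using that by (auto simp: mem_L2_class_of_iff)
    then have "AE x in lebesgue_on \<Omega>. u' x + v' x = u x + v x"
      by eventually_elim simp
    then show ?thesis
      using that by (subst L2_class_of_eq_iff)
        (auto simp: mem_L2_class_of_iff sq_integrable_on_add)
  qed
  have "u \<in> L2_class_of \<Omega> u" "v \<in> L2_class_of \<Omega> v"
    using assms by (auto simp: mem_L2_class_of_iff)
  then have "L2_class_of \<Omega> u \<noteq> {}" "L2_class_of \<Omega> v \<noteq> {}"
    by auto
  moreover have "L2_add \<Omega> (L2_class_of \<Omega> u) (L2_class_of \<Omega> v) =
      (\<Union>u'\<in>L2_class_of \<Omega> u. \<Union>v'\<in>L2_class_of \<Omega> v. L2_class_of \<Omega> (\<lambda>x. u x + v x))"
    unfolding L2_add_def by (intro SUP_cong refl *)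
  ultimately show ?thesis
    by simp
qed

lemma L2_scale_class_of:
  assumes "u \<in> sq_integrable_on \<Omega>"
  shows "L2_scale \<Omega> c (L2_class_of \<Omega> u) = L2_class_of \<Omega> (\<lambda>x. c * u x)"
proof -
  have *: "L2_class_of \<Omega> (\<lambda>x. c * u' x) = L2_class_of \<Omega> (\<lambda>x. c * u x)"
    if "u' \<in> L2_class_of \<Omega> u" for u'
  proof -
    have "AE x in lebesgue_on \<Omega>. u x = u' x"
      using that by (auto simp: mem_L2_class_of_iff)
    then have "AE x in lebesgue_on \<Omega>. c * u' x = c * u x"
      by eventually_elim simp
    then show ?thesis
      using that by (subst L2_class_of_eq_iff)
        (auto simp: mem_L2_class_of_iff sq_integrable_on_scale)
  qed
  have "u \<in> L2_class_of \<Omega> u"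
    using assms by (auto simp: mem_L2_class_of_iff)
  then have "L2_class_of \<Omega> u \<noteq> {}"
    by auto
  moreover have "L2_scale \<Omega> c (L2_class_of \<Omega> u) =
      (\<Union>u'\<in>L2_class_of \<Omega> u. L2_class_of \<Omega> (\<lambda>x. c * u x))"
    unfolding L2_scale_def by (intro SUP_cong refl *)
  ultimately show ?thesis
    by simp
qed

lemma L2_inner_class_of:
  assumes "u \<in> sq_integrable_on \<Omega>" "v \<in> sq_integrable_on \<Omega>"
  shows "L2_inner \<Omega> (L2_class_of \<Omega> u) (L2_class_of \<Omega> v) =
           (LINT x|lebesgue_on \<Omega>. u x * cnj (v x))"
proof -
  have *: "(LINT x|lebesgue_on \<Omega>. u x * cnj (v x)) = (LINT x|lebesgue_on \<Omega>. u' x * cnj (v' x))"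
    if "u' \<in> L2_class_of \<Omega> u" "v' \<in> L2_class_of \<Omega> v" for u' v'
  proof (rule integral_cong_AE)
    have "AE x in lebesgue_on \<Omega>. u x = u' x" "AE x in lebesgue_on \<Omega>. v x = v' x"
      using that by (auto simp: mem_L2_class_of_iff)
    then show "AE x in lebesgue_on \<Omega>. u x * cnj (v x) = u' x * cnj (v' x)"
      by eventually_elim simp
    have cnj: "(\<lambda>x. cnj (w x)) \<in> borel_measurable (lebesgue_on \<Omega>)"
      if "w \<in> borel_measurable (lebesgue_on \<Omega>)" for w :: "'a \<Rightarrow> complex"
      using that by (rule borel_measurable_continuous_on[rotated]) (intro continuous_intros)
    show "(\<lambda>x. u x * cnj (v x)) \<in> borel_measurable (lebesgue_on \<Omega>)"
      using assms by (intro borel_measurable_times cnj) (auto simp: sq_integrable_on_def)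
    show "(\<lambda>x. u' x * cnj (v' x)) \<in> borel_measurable (lebesgue_on \<Omega>)"
      using that by (intro borel_measurable_times cnj)
        (auto simp: mem_L2_class_of_iff sq_integrable_on_def)
  qed
  have mem: "u \<in> L2_class_of \<Omega> u" "v \<in> L2_class_of \<Omega> v"
    using assms by (auto simp: mem_L2_class_of_iff)
  show ?thesis
    unfolding L2_inner_def
  proof (rule the_equality)
    fix c
    assume "\<forall>u'\<in>L2_class_of \<Omega> u. \<forall>v'\<in>L2_class_of \<Omega> v.
      c = (LINT x|lebesgue_on \<Omega>. u' x * cnj (v' x))"
    from bspec[OF bspec[OF this mem(1)] mem(2)]
    show "c = (LINT x|lebesgue_on \<Omega>. u x * cnj (v x))" .
  qed (intro ballI *)
qed

lemma continuous_rep_unique: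
  fixes g h :: "'a::euclidean_space \<Rightarrow> complex"
  assumes "open \<Omega>"
    and g: "continuous_on (closure \<Omega>) g" and h: "continuous_on (closure \<Omega>) h"
    and ae: "AE x in lebesgue_on \<Omega>. g x = h x"
    and "x \<in> closure \<Omega>"
  shows "g x = h x"
proof -
  let ?N = "\<Omega> \<inter> {x. g x \<noteq> h x}"
  have cd: "continuous_on (closure \<Omega>) (\<lambda>x. g x - h x)"
    by (intro continuous_intros g h)
  have "open (\<Omega> \<inter> (\<lambda>x. g x - h x) -` (- {0}))"
    using continuous_on_subset[OF cd closure_subset] \<open>open \<Omega>\<close>
    by (intro continuous_open_preimage) auto
  then have "open ?N"
    by (auto simp: vimage_def)
  moreover have "negligible ?N"
  proof -
    have "AE x in lebesgue. x \<in> \<Omega> \<longrightarrow> g x = h x"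
      using ae \<open>open \<Omega>\<close> by (simp add: AE_restrict_space_iff)
    then have "{x. \<not> (x \<in> \<Omega> \<longrightarrow> g x = h x)} \<in> null_sets lebesgue"
      by (simp add: completion.AE_iff_null_sets)
    then show ?thesis
      by (simp add: negligible_iff_null_sets Int_def)
  qed
  ultimately have "?N = {}"
    using open_not_negligible by blast
  then have "\<And>x. x \<in> \<Omega> \<Longrightarrow> g x - h x = 0"
    by auto
  then have "g x - h x = 0"
    using continuous_constant_on_closure[OF cd _ \<open>x \<in> closure \<Omega>\<close>] by blast
  then show ?thesis by simp
qed

lemma continuous_rep_value_eq:
  assumes "open \<Omega>" "f \<in> L2 \<Omega>" "g \<in> f" "continuous_on (closure \<Omega>) g" "x \<in> closure \<Omega>"
  shows "continuous_rep_value \<Omega> f x = g x"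
proof -
  have "h x = g x" if "h \<in> f" "continuous_on (closure \<Omega>) h" for h
  proof (rule continuous_rep_unique[OF \<open>open \<Omega>\<close> that(2) assms(4) _ \<open>x \<in> closure \<Omega>\<close>])
    obtain u where u: "f = L2_class_of \<Omega> u"
      using assms(2) by (rule L2_cases)
    have "AE x in lebesgue_on \<Omega>. u x = h x" "AE x in lebesgue_on \<Omega>. u x = g x"
      using that(1) assms(3) by (auto simp: u mem_L2_class_of_iff)
    then show "AE x in lebesgue_on \<Omega>. h x = g x"
      by eventually_elim simp
  qed
  with assms(3,4) show ?thesis
    unfolding continuous_rep_value_def by (intro the_equality) blast+
qed

end

theory Submission
  imports Defs
begin

text \<open>
  Write \<open>A u\<close> for the continuous representative of \<open>T u\<close>. By uniform boundedness and symmetry,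
  \<open>A\<close> is bounded from \<open>L\<^sup>2\<close> to the sup norm, so by Riesz \<open>A u x = \<langle>u, k x\<rangle>\<close> with \<open>k x\<close> bounded in
  \<open>L\<^sup>2\<close>. Moving two factors of \<open>T\<close> across the inner product gives the kernel
  \<open>K (x, y) = cnj \<langle>A (k x), k y\<rangle>\<close>. Here \<open>k y\<close> depends on \<open>y\<close> only weakly continuously, but \<open>A (k x)\<close>
  depends on \<open>x\<close> norm continuously: it is uniformly bounded and \<open>A (k x) z = \<langle>k x, k z\<rangle>\<close> converges
  pointwise in \<open>z\<close>, so dominated convergence applies. Hence the pairing is jointly continuous.
\<close>

section \<open>The semi-inner product on square-integrable functions\<close>

text \<open>Kept on functions rather than classes, because pointwise values of \<open>A u\<close> on
  the closure are needed later.\<close>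

definition sq_inner :: "'a::euclidean_space set \<Rightarrow> ('a \<Rightarrow> complex) \<Rightarrow> ('a \<Rightarrow> complex) \<Rightarrow> complex" where
  "sq_inner \<Omega> u v = (LINT x|lebesgue_on \<Omega>. u x * cnj (v x))"

definition sq_norm :: "'a::euclidean_space set \<Rightarrow> ('a \<Rightarrow> complex) \<Rightarrow> real" where
  "sq_norm \<Omega> u = sqrt (LINT x|lebesgue_on \<Omega>. (cmod (u x))\<^sup>2)"

lemma borel_measurable_cnj [measurable (raw)]:
  fixes u :: "'a \<Rightarrow> complex"
  shows "u \<in> borel_measurable M \<Longrightarrow> (\<lambda>x. cnj (u x)) \<in> borel_measurable M"
  by (rule borel_measurable_continuous_on[of cnj]) (intro continuous_intros)

lemma sq_integrable_on_measurable [measurable_dest]: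
  "u \<in> sq_integrable_on \<Omega> \<Longrightarrow> u \<in> borel_measurable (lebesgue_on \<Omega>)"
  by (simp add: sq_integrable_on_def)

lemma sq_integrable_on_integrable_square:
  "u \<in> sq_integrable_on \<Omega> \<Longrightarrow> integrable (lebesgue_on \<Omega>) (\<lambda>x. (cmod (u x))\<^sup>2)"
  by (simp add: sq_integrable_on_def)

lemma sq_integrable_on_diff:
  assumes "u \<in> sq_integrable_on \<Omega>" "v \<in> sq_integrable_on \<Omega>"
  shows "(\<lambda>x. u x - v x) \<in> sq_integrable_on \<Omega>"
  using sq_integrable_on_add[OF assms(1) sq_integrable_on_scale[OF assms(2), of "-1"]] by simp

lemma sq_integrable_on_zero [simp]: "(\<lambda>x. 0) \<in> sq_integrable_on \<Omega>"
  by (simp add: sq_integrable_on_def)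

text \<open>Weighted AM-GM, from expanding a square. Weight 1 dominates products by squares; an
  optimal weight gives Cauchy-Schwarz.\<close>

lemma two_mult_le_weighted_squares:
  fixes a b t :: real
  assumes "t > 0"
  shows "2 * (a * b) \<le> t * a\<^sup>2 + b\<^sup>2 / t"
proof -
  have "0 \<le> (t * a - b)\<^sup>2 / t"
    using assms by simp
  also have "\<dots> = t * a\<^sup>2 + b\<^sup>2 / t - 2 * (a * b)"
    using assms by (simp add: power2_diff field_simps power2_eq_square)
  finally show ?thesis by simp
qed

lemma sq_integrable_on_integrable_norm_mult:
  assumes "u \<in> sq_integrable_on \<Omega>" "v \<in> sq_integrable_on \<Omega>"
  shows "integrable (lebesgue_on \<Omega>) (\<lambda>x. cmod (u x) * cmod (v x))"
proof (rule Bochner_Integration.integrable_bound)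
  show "integrable (lebesgue_on \<Omega>) (\<lambda>x. (cmod (u x))\<^sup>2 + (cmod (v x))\<^sup>2)"
    using assms by (simp add: sq_integrable_on_integrable_square)
  have "cmod (u x) * cmod (v x) \<le> (cmod (u x))\<^sup>2 + (cmod (v x))\<^sup>2" for x
    using two_mult_le_weighted_squares[of 1 "cmod (u x)" "cmod (v x)"]
    by (smt (verit) div_by_1 mult_cancel_right1 mult_nonneg_nonneg norm_ge_zero)
  then show "AE x in lebesgue_on \<Omega>. norm (cmod (u x) * cmod (v x))
      \<le> norm ((cmod (u x))\<^sup>2 + (cmod (v x))\<^sup>2)"
    by simp
qed (use assms in measurable)

lemma sq_integrable_on_integrable_mult_cnj:
  assumes "u \<in> sq_integrable_on \<Omega>" "v \<in> sq_integrable_on \<Omega>"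
  shows "integrable (lebesgue_on \<Omega>) (\<lambda>x. u x * cnj (v x))"
  by (rule Bochner_Integration.integrable_bound[OF sq_integrable_on_integrable_norm_mult[OF assms]])
    (use assms in \<open>auto simp: norm_mult\<close>)

lemma sq_inner_cnj: "cnj (sq_inner \<Omega> u v) = sq_inner \<Omega> v u"
  by (simp add: sq_inner_def mult.commute flip: Bochner_Integration.integral_cnj)

lemma sq_inner_add_left:
  assumes "u \<in> sq_integrable_on \<Omega>" "v \<in> sq_integrable_on \<Omega>" "w \<in> sq_integrable_on \<Omega>"
  shows "sq_inner \<Omega> (\<lambda>x. u x + v x) w = sq_inner \<Omega> u w + sq_inner \<Omega> v w"
  using assms by (simp add: sq_inner_def sq_integrable_on_integrable_mult_cnj distrib_right)

lemma sq_inner_diff_left: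
  assumes "u \<in> sq_integrable_on \<Omega>" "v \<in> sq_integrable_on \<Omega>" "w \<in> sq_integrable_on \<Omega>"
  shows "sq_inner \<Omega> (\<lambda>x. u x - v x) w = sq_inner \<Omega> u w - sq_inner \<Omega> v w"
  using assms by (simp add: sq_inner_def sq_integrable_on_integrable_mult_cnj left_diff_distrib)

lemma sq_inner_scale_left: "sq_inner \<Omega> (\<lambda>x. c * u x) v = c * sq_inner \<Omega> u v"
  by (simp add: sq_inner_def mult.assoc)

lemma sq_norm_nonneg [simp]: "sq_norm \<Omega> u \<ge> 0"
  by (simp add: sq_norm_def)

lemma sq_norm_square: "(sq_norm \<Omega> u)\<^sup>2 = (LINT x|lebesgue_on \<Omega>. (cmod (u x))\<^sup>2)"
  by (simp add: sq_norm_def)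

lemma sq_inner_self: "sq_inner \<Omega> u u = of_real ((sq_norm \<Omega> u)\<^sup>2)"
  by (simp add: sq_norm_square sq_inner_def complex_norm_square[symmetric] del: of_real_power
      flip: integral_complex_of_real)

lemma sq_norm_scale: "sq_norm \<Omega> (\<lambda>x. c * u x) = cmod c * sq_norm \<Omega> u"
  by (simp add: sq_norm_def norm_mult power_mult_distrib real_sqrt_mult)

lemma sq_norm_minus_commute: "sq_norm \<Omega> (\<lambda>x. u x - v x) = sq_norm \<Omega> (\<lambda>x. v x - u x)"
  by (simp add: sq_norm_def norm_minus_commute)

text \<open>Integrate the weighted inequality and take the weight that balances its two terms, the
  quotient of the norms. The absolute values inside the integral serve the \<open>L\<^sup>1\<close>
  estimate in \<open>sq_norm_complete\<close>.\<close>

lemma Cauchy_Schwarz_integral: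
  assumes "u \<in> sq_integrable_on \<Omega>" "v \<in> sq_integrable_on \<Omega>"
  shows "(LINT x|lebesgue_on \<Omega>. cmod (u x) * cmod (v x)) \<le> sq_norm \<Omega> u * sq_norm \<Omega> v"
proof -
  let ?I = "LINT x|lebesgue_on \<Omega>. cmod (u x) * cmod (v x)"
  let ?a = "sq_norm \<Omega> u" and ?b = "sq_norm \<Omega> v"
  have le: "2 * ?I \<le> t * ?a\<^sup>2 + ?b\<^sup>2 / t" if "t > 0" for t
  proof -
    have "2 * ?I = (LINT x|lebesgue_on \<Omega>. 2 * (cmod (u x) * cmod (v x)))"
      by simp
    also have "\<dots> \<le> (LINT x|lebesgue_on \<Omega>. t * (cmod (u x))\<^sup>2 + (cmod (v x))\<^sup>2 / t)"
      using assms two_mult_le_weighted_squares[OF that]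
      by (intro integral_mono integrable_mult_right sq_integrable_on_integrable_norm_mult
          Bochner_Integration.integrable_add integrable_divide_zero)
        (auto simp: sq_integrable_on_integrable_square)
    also have "\<dots> = t * ?a\<^sup>2 + ?b\<^sup>2 / t"
      using assms by (simp add: sq_norm_square sq_integrable_on_integrable_square)
    finally show ?thesis .
  qed
  \<comment> \<open>Enlarging both norms by \<open>e\<close> keeps the weight
    \<open>(?b + e) / (?a + e)\<close> well defined and positive even if a norm vanishes;
    \<open>e\<close> then tends to 0.\<close>
  have perturbed: "?I \<le> (?a + e) * (?b + e)" if "e > 0" for e
  proof -
    have a: "?a + e > 0" and b: "?b + e > 0"
      using that by (simp_all add: add_nonneg_pos)
    have "2 * ?I \<le> (?b + e) / (?a + e) * ?a\<^sup>2 + ?b\<^sup>2 / ((?b + e) / (?a + e))"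
      using a b by (intro le) simp
    also have "\<dots> \<le> (?b + e) / (?a + e) * (?a + e)\<^sup>2 + (?b + e)\<^sup>2 / ((?b + e) / (?a + e))"
      using a b that by (intro add_mono mult_left_mono divide_right_mono power_mono) auto
    also have "\<dots> = 2 * ((?a + e) * (?b + e))"
      using a b by (simp add: power2_eq_square)
    finally show ?thesis by simp
  qed
  have "((\<lambda>e. (?a + e) * (?b + e)) \<longlongrightarrow> (?a + 0) * (?b + 0)) (at_right 0)"
    by (intro tendsto_intros)
  moreover have "eventually (\<lambda>e. ?I \<le> (?a + e) * (?b + e)) (at_right 0)"
    using perturbed eventually_at_right_less[of "0::real"] by (auto elim!: eventually_mono)
  ultimately show ?thesis
    using tendsto_lowerbound[of _ "?a * ?b" "at_right (0::real)" ?I] by simp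
qed

lemma Cauchy_Schwarz_sq_inner:
  assumes "u \<in> sq_integrable_on \<Omega>" "v \<in> sq_integrable_on \<Omega>"
  shows "cmod (sq_inner \<Omega> u v) \<le> sq_norm \<Omega> u * sq_norm \<Omega> v"
proof -
  have "cmod (sq_inner \<Omega> u v) \<le> (LINT x|lebesgue_on \<Omega>. cmod (u x * cnj (v x)))"
    unfolding sq_inner_def by (rule integral_norm_bound)
  also have "\<dots> \<le> sq_norm \<Omega> u * sq_norm \<Omega> v"
    using Cauchy_Schwarz_integral[OF assms] by (simp add: norm_mult)
  finally show ?thesis .
qed

text \<open>The values 1 and -1 of \<open>c\<close> yield the triangle inequality and the
  parallelogram law; real \<open>c\<close> give the variations in
  \<open>sq_inner_Riesz\<close>.\<close>

lemma sq_norm_add_scaled_square: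
  assumes "u \<in> sq_integrable_on \<Omega>" "v \<in> sq_integrable_on \<Omega>"
  shows "(sq_norm \<Omega> (\<lambda>x. u x + c * v x))\<^sup>2 =
    (sq_norm \<Omega> u)\<^sup>2 + 2 * Re (c * sq_inner \<Omega> v u) + (cmod c)\<^sup>2 * (sq_norm \<Omega> v)\<^sup>2"
proof -
  let ?S = "sq_integrable_on \<Omega>"
  let ?w = "\<lambda>x. u x + c * v x"
  have cv: "(\<lambda>x. c * v x) \<in> ?S" and w: "?w \<in> ?S"
    using assms by (auto intro: sq_integrable_on_scale sq_integrable_on_add)
  have left: "sq_inner \<Omega> ?w z = sq_inner \<Omega> u z + c * sq_inner \<Omega> v z" if "z \<in> ?S" for z
    using sq_inner_add_left[OF assms(1) cv that] by (simp add: sq_inner_scale_left)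
  have right: "sq_inner \<Omega> z ?w = sq_inner \<Omega> z u + cnj c * sq_inner \<Omega> z v" if "z \<in> ?S" for z
    using arg_cong[OF left[OF that], of cnj] by (simp add: sq_inner_cnj)
  have "sq_inner \<Omega> ?w ?w = sq_inner \<Omega> u u + cnj c * sq_inner \<Omega> u v
      + c * (sq_inner \<Omega> v u + cnj c * sq_inner \<Omega> v v)"
    using assms w by (simp add: left right)
  also have "cnj c * sq_inner \<Omega> u v = cnj (c * sq_inner \<Omega> v u)"
    by (simp add: sq_inner_cnj)
  finally have "Re (sq_inner \<Omega> ?w ?w) = Re (sq_inner \<Omega> u u) + 2 * Re (c * sq_inner \<Omega> v u)
      + Re (c * cnj c * sq_inner \<Omega> v v)"
    by (simp add: algebra_simps)
  then show ?thesis
    by (simp add: sq_inner_self complex_mult_cnj cmod_power2 flip: of_real_mult of_real_add of_real_power)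
qed

lemma sq_norm_triangle_ineq:
  assumes "u \<in> sq_integrable_on \<Omega>" "v \<in> sq_integrable_on \<Omega>"
  shows "sq_norm \<Omega> (\<lambda>x. u x + v x) \<le> sq_norm \<Omega> u + sq_norm \<Omega> v"
proof (rule power2_le_imp_le)
  have "Re (sq_inner \<Omega> v u) \<le> sq_norm \<Omega> u * sq_norm \<Omega> v"
    using Cauchy_Schwarz_sq_inner[OF assms(2,1)] complex_Re_le_cmod[of "sq_inner \<Omega> v u"]
    by (simp add: mult.commute)
  then show "(sq_norm \<Omega> (\<lambda>x. u x + v x))\<^sup>2 \<le> (sq_norm \<Omega> u + sq_norm \<Omega> v)\<^sup>2"
    using sq_norm_add_scaled_square[OF assms, of 1] by (simp add: power2_sum)
qed simp

lemma sq_norm_triangle_ineq3: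
  assumes "u \<in> sq_integrable_on \<Omega>" "v \<in> sq_integrable_on \<Omega>"
  shows "\<bar>sq_norm \<Omega> u - sq_norm \<Omega> v\<bar> \<le> sq_norm \<Omega> (\<lambda>x. u x - v x)"
proof -
  have "sq_norm \<Omega> u \<le> sq_norm \<Omega> v + sq_norm \<Omega> (\<lambda>x. u x - v x)"
    using sq_norm_triangle_ineq[OF assms(2) sq_integrable_on_diff[OF assms]] by simp
  moreover have "sq_norm \<Omega> v \<le> sq_norm \<Omega> u + sq_norm \<Omega> (\<lambda>x. v x - u x)"
    using sq_norm_triangle_ineq[OF assms(1) sq_integrable_on_diff[OF assms(2,1)]] by simp
  ultimately show ?thesis
    by (simp add: sq_norm_minus_commute[of \<Omega> v u])
qed

lemma sq_norm_parallelogram: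
  assumes "u \<in> sq_integrable_on \<Omega>" "v \<in> sq_integrable_on \<Omega>"
  shows "(sq_norm \<Omega> (\<lambda>x. u x - v x))\<^sup>2 =
    2 * (sq_norm \<Omega> u)\<^sup>2 + 2 * (sq_norm \<Omega> v)\<^sup>2 - (sq_norm \<Omega> (\<lambda>x. u x + v x))\<^sup>2"
  using sq_norm_add_scaled_square[OF assms, of 1] sq_norm_add_scaled_square[OF assms, of "-1"]
  by simp

section \<open>Completeness, uniform boundedness and Riesz representation\<close>

lemma sq_integrable_on_bounded:
  assumes "finite_measure (lebesgue_on \<Omega>)" "u \<in> borel_measurable (lebesgue_on \<Omega>)"
    and "\<And>x. x \<in> \<Omega> \<Longrightarrow> cmod (u x) \<le> B"
  shows "u \<in> sq_integrable_on \<Omega>"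
proof -
  have "integrable (lebesgue_on \<Omega>) (\<lambda>x. (cmod (u x))\<^sup>2)"
  proof (rule finite_measure.integrable_const_bound[OF assms(1), where B = "B\<^sup>2"])
    show "AE x in lebesgue_on \<Omega>. norm ((cmod (u x))\<^sup>2) \<le> B\<^sup>2"
      using assms(3) by (intro AE_I2) (auto intro: power_mono)
  qed (use assms(2) in measurable)
  then show ?thesis
    using assms(2) by (simp add: sq_integrable_on_def)
qed

lemma sq_integrable_on_integrable_norm:
  assumes "finite_measure (lebesgue_on \<Omega>)" "u \<in> sq_integrable_on \<Omega>"
  shows "integrable (lebesgue_on \<Omega>) (\<lambda>x. cmod (u x))"
  using sq_integrable_on_integrable_norm_mult[OF assms(2) sq_integrable_on_bounded[OF assms(1), of "\<lambda>x. 1" 1]]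
  by simp

text \<open>Riesz-Fischer. On a finite measure space the sequence is also Cauchy in
  \<open>L\<^sup>1\<close>, so a subsequence converges almost everywhere. Fatou's lemma carries the
  rate \<open>e\<close> over to the limit; the gliding hump below needs this explicit rate.\<close>

lemma sq_norm_complete:
  assumes fin: "finite_measure (lebesgue_on \<Omega>)"
    and u: "\<And>n. u n \<in> sq_integrable_on \<Omega>"
    and cauchy: "\<And>m n. n \<le> m \<Longrightarrow> sq_norm \<Omega> (\<lambda>x. u m x - u n x) \<le> e n"
    and e: "e \<longlonglongrightarrow> 0"
  obtains v where "v \<in> sq_integrable_on \<Omega>" "\<And>n. sq_norm \<Omega> (\<lambda>x. v x - u n x) \<le> e n"
proof -
  let ?S = "sq_integrable_on \<Omega>" and ?M = "lebesgue_on \<Omega>"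
  have [measurable]: "u n \<in> borel_measurable ?M" for n
    using u by (rule sq_integrable_on_measurable)
  have one: "(\<lambda>x. 1) \<in> ?S"
    by (rule sq_integrable_on_bounded[OF fin, of _ 1]) auto
  let ?K = "sq_norm \<Omega> (\<lambda>x. 1)"
  have e0: "e n \<ge> 0" for n
    using order_trans[OF sq_norm_nonneg cauchy[of n n]] by simp
  have L1: "(LINT x|?M. norm (u i x - u j x)) \<le> e n * 2 * ?K" if "n \<le> i" "n \<le> j" for i j n
  proof -
    have "(LINT x|?M. norm (u i x - u j x)) \<le> sq_norm \<Omega> (\<lambda>x. u i x - u j x) * ?K"
      using Cauchy_Schwarz_integral[OF sq_integrable_on_diff[OF u u] one, of i j] by simp
    also have "sq_norm \<Omega> (\<lambda>x. u i x - u j x) \<le>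
        sq_norm \<Omega> (\<lambda>x. u i x - u n x) + sq_norm \<Omega> (\<lambda>x. u n x - u j x)"
      using sq_norm_triangle_ineq[OF sq_integrable_on_diff[OF u u] sq_integrable_on_diff[OF u u],
          of i n n j] by simp
    also have "\<dots> \<le> e n + e n"
      using that cauchy by (intro add_mono) (auto simp: sq_norm_minus_commute[of \<Omega> "u n" "u j"])
    finally show ?thesis
      by (simp add: mult_right_mono)
  qed
  obtain r where r: "strict_mono r" and AE_Cauchy: "AE x in ?M. Cauchy (\<lambda>i. u (r i) x)"
  proof (rule cauchy_L1_AE_cauchy_subseq[of ?M u])
    show "integrable ?M (u n)" for n
      using sq_integrable_on_integrable_norm[OF fin u] by (simp add: integrable_norm_iff)
    fix d :: real
    assume "d > 0"
    have "(\<lambda>n. e n * 2 * ?K) \<longlonglongrightarrow> 0 * 2 * ?K"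
      by (intro tendsto_intros e)
    with \<open>d > 0\<close> have "eventually (\<lambda>n. e n * 2 * ?K < d) sequentially"
      by (intro order_tendstoD(2)) auto
    then obtain N where "e N * 2 * ?K < d"
      by (auto simp: eventually_sequentially)
    then show "\<exists>N. \<forall>i\<ge>N. \<forall>j\<ge>N. (LINT x|?M. norm (u i x - u j x)) < d"
      using L1 by (meson order_le_less_trans)
  qed
  define v where "v = (\<lambda>x. lim (\<lambda>i. u (r i) x))"
  have [measurable]: "v \<in> borel_measurable ?M"
    unfolding v_def by measurable
  have lim: "AE x in ?M. (\<lambda>i. u (r i) x) \<longlonglongrightarrow> v x"
    using AE_Cauchy by eventually_elim (simp add: v_def Cauchy_convergent_iff convergent_LIMSEQ_iff)
  have Fatou: "(\<integral>\<^sup>+x. ennreal ((cmod (v x - u n x))\<^sup>2) \<partial>?M) \<le> ennreal ((e n)\<^sup>2)" for n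
  proof -
    have "(\<integral>\<^sup>+x. ennreal ((cmod (v x - u n x))\<^sup>2) \<partial>?M)
        = (\<integral>\<^sup>+x. liminf (\<lambda>i. ennreal ((cmod (u (r i) x - u n x))\<^sup>2)) \<partial>?M)"
    proof (rule nn_integral_cong_AE)
      show "AE x in ?M. ennreal ((cmod (v x - u n x))\<^sup>2)
          = liminf (\<lambda>i. ennreal ((cmod (u (r i) x - u n x))\<^sup>2))"
        using lim
      proof eventually_elim
        case (elim x)
        then have "(\<lambda>i. ennreal ((cmod (u (r i) x - u n x))\<^sup>2)) \<longlonglongrightarrow> ennreal ((cmod (v x - u n x))\<^sup>2)"
          by (intro tendsto_intros)
        then show ?case
          by (rule lim_imp_Liminf[OF sequentially_bot, symmetric])
      qed
    qed
    also have "\<dots> \<le> liminf (\<lambda>i. \<integral>\<^sup>+x. ennreal ((cmod (u (r i) x - u n x))\<^sup>2) \<partial>?M)"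
      by (rule nn_integral_liminf) measurable
    also have "\<dots> \<le> liminf (\<lambda>i. ennreal ((e n)\<^sup>2))"
    \<comment> \<open>Only indices \<open>i\<close> at least \<open>n\<close> matter for the limit
      inferior; there \<open>r i\<close> is at least \<open>n\<close> too, so the Cauchy estimate
      applies.\<close>
    proof (rule Liminf_mono)
      have "(\<integral>\<^sup>+x. ennreal ((cmod (u (r i) x - u n x))\<^sup>2) \<partial>?M) \<le> ennreal ((e n)\<^sup>2)" if "n \<le> i" for i
      proof -
        have "(sq_norm \<Omega> (\<lambda>x. u (r i) x - u n x))\<^sup>2 \<le> (e n)\<^sup>2"
          using order_trans[OF that seq_suble[OF r]] by (intro power_mono cauchy) auto
        then show ?thesis
          using sq_integrable_on_integrable_square[OF sq_integrable_on_diff[OF u u], of "r i" n]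
          by (subst nn_integral_eq_integral) (auto simp: sq_norm_square intro: ennreal_leI)
      qed
      then show "eventually (\<lambda>i. (\<integral>\<^sup>+x. ennreal ((cmod (u (r i) x - u n x))\<^sup>2) \<partial>?M)
          \<le> ennreal ((e n)\<^sup>2)) sequentially"
        by (auto simp: eventually_sequentially)
    qed
    also have "\<dots> = ennreal ((e n)\<^sup>2)"
      by (simp add: Liminf_const)
    finally show ?thesis .
  qed
  have diff: "(\<lambda>x. v x - u n x) \<in> ?S" for n
  proof -
    have "integrable ?M (\<lambda>x. (cmod (v x - u n x))\<^sup>2)"
      by (rule integrableI_nonneg) (auto intro: le_less_trans[OF Fatou])
    then show ?thesis
      by (simp add: sq_integrable_on_def)
  qed
  show thesis
  proof
    show "v \<in> ?S"
      using sq_integrable_on_add[OF diff u, of 0 0] by simp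
    show "sq_norm \<Omega> (\<lambda>x. v x - u n x) \<le> e n" for n
    proof (rule power2_le_imp_le[OF _ e0])
      have "ennreal ((sq_norm \<Omega> (\<lambda>x. v x - u n x))\<^sup>2) = (\<integral>\<^sup>+x. ennreal ((cmod (v x - u n x))\<^sup>2) \<partial>?M)"
        unfolding sq_norm_square
        using sq_integrable_on_integrable_square[OF diff] by (subst nn_integral_eq_integral) auto
      with Fatou[of n] have "ennreal ((sq_norm \<Omega> (\<lambda>x. v x - u n x))\<^sup>2) \<le> ennreal ((e n)\<^sup>2)"
        by simp
      then show "(sq_norm \<Omega> (\<lambda>x. v x - u n x))\<^sup>2 \<le> (e n)\<^sup>2"
        by (simp add: ennreal_le_iff)
    qed
  qed
qed

text \<open>The weights \<open>w\<close> replace a normalization of the family, which would fail for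
  indices of weight 0. In \<open>sup_bound\<close> they are \<open>L\<^sup>1\<close> norms.\<close>

lemma sq_norm_uniformly_bounded:
  fixes h :: "'i \<Rightarrow> 'a::euclidean_space \<Rightarrow> complex" and w :: "'i \<Rightarrow> real"
  assumes fin: "finite_measure (lebesgue_on \<Omega>)"
    and h: "\<And>i. i \<in> I \<Longrightarrow> h i \<in> sq_integrable_on \<Omega>"
    and w: "\<And>i. i \<in> I \<Longrightarrow> w i \<ge> 0"
    and bounded: "\<And>u. u \<in> sq_integrable_on \<Omega> \<Longrightarrow>
      \<exists>B. \<forall>i\<in>I. cmod (sq_inner \<Omega> u (h i)) \<le> B * w i"
  shows "\<exists>C. \<forall>i\<in>I. sq_norm \<Omega> (h i) \<le> C * w i"
proof (rule ccontr)
  let ?S = "sq_integrable_on \<Omega>"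
  assume "\<not> ?thesis"
  \<comment> \<open>The growth 8^n outruns the decay 4^-n of the humps, so a factor 2^n survives to
    contradict the bound \<open>B\<close>.\<close>
  then have "\<forall>n::nat. \<exists>i. i \<in> I \<and> 8 ^ n * w i < sq_norm \<Omega> (h i)"
    by (meson not_le)
  then obtain i where i: "\<And>n. i n \<in> I" and big: "\<And>n. 8 ^ n * w (i n) < sq_norm \<Omega> (h (i n))"
    by metis
  define g where "g n = h (i n)" for n
  have g: "g n \<in> ?S" for n
    using h i by (simp add: g_def)
  have pos: "sq_norm \<Omega> (g n) > 0" for n
    unfolding g_def using w[OF i] by (intro le_less_trans[OF _ big]) simp
  \<comment> \<open>With this factor the hump \<open>c n * g n\<close> has norm 4^-n and its pairing
    with \<open>g n\<close> is 4^-n times the norm of \<open>g n\<close>. Hence either the old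
    pairing is already at least half of that, or adding the hump makes it so.\<close>
  define c where "c n = complex_of_real ((1/4) ^ n / sq_norm \<Omega> (g n))" for n
  have c: "cmod (c n) = (1/4) ^ n / sq_norm \<Omega> (g n)" for n
    by (simp add: c_def norm_divide norm_power)
  \<comment> \<open>Gliding hump: step \<open>n\<close> makes the pairing with \<open>g n\<close> at least \<open>1/2 * 4\<^sup>-\<^sup>n * sq_norm \<Omega> (g n)\<close>, and all
    later steps together change it by at most \<open>1/3 * 4\<^sup>-\<^sup>n * sq_norm \<Omega> (g n)\<close>.\<close>
  define U where "U = rec_nat (\<lambda>x. 0) (\<lambda>n v.
    if cmod (sq_inner \<Omega> v (g n)) \<ge> 1/2 * (1/4) ^ n * sq_norm \<Omega> (g n) then v
    else (\<lambda>x. v x + c n * g n x))"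
  have U_0: "U 0 = (\<lambda>x. 0)"
    and U_Suc: "U (Suc n) = (if cmod (sq_inner \<Omega> (U n) (g n)) \<ge> 1/2 * (1/4) ^ n * sq_norm \<Omega> (g n)
      then U n else (\<lambda>x. U n x + c n * g n x))" for n
    by (simp_all add: U_def)
  have U: "U n \<in> ?S" for n
    by (induction n) (auto simp: U_0 U_Suc intro!: sq_integrable_on_add sq_integrable_on_scale g)
  have lower: "cmod (sq_inner \<Omega> (U (Suc n)) (g n)) \<ge> 1/2 * (1/4) ^ n * sq_norm \<Omega> (g n)" for n
  proof (cases "cmod (sq_inner \<Omega> (U n) (g n)) \<ge> 1/2 * (1/4) ^ n * sq_norm \<Omega> (g n)")
    case False
    have "sq_inner \<Omega> (U (Suc n)) (g n) = sq_inner \<Omega> (U n) (g n) + c n * sq_inner \<Omega> (g n) (g n)"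
      using False sq_inner_add_left[OF U sq_integrable_on_scale[OF g] g]
      by (simp add: U_Suc sq_inner_scale_left)
    then have "cmod (sq_inner \<Omega> (U (Suc n)) (g n))
        \<ge> cmod (c n * sq_inner \<Omega> (g n) (g n)) - cmod (sq_inner \<Omega> (U n) (g n))"
      by (metis add.commute norm_diff_ineq)
    moreover have "cmod (c n * sq_inner \<Omega> (g n) (g n)) = (1/4) ^ n * sq_norm \<Omega> (g n)"
      using pos[of n] by (simp add: norm_mult c sq_inner_self norm_power power2_eq_square)
    ultimately show ?thesis
      using False by simp
  qed (simp add: U_Suc)
  have step: "sq_norm \<Omega> (\<lambda>x. U (Suc n) x - U n x) \<le> (1/4) ^ n" for n
  proof (cases "cmod (sq_inner \<Omega> (U n) (g n)) \<ge> 1/2 * (1/4) ^ n * sq_norm \<Omega> (g n)")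
    case True
    then show ?thesis
      by (simp add: U_Suc sq_norm_def)
  next
    case False
    then show ?thesis
      using pos[of n] by (simp add: U_Suc sq_norm_scale c)
  qed
  \<comment> \<open>Keeping the exact geometric sum, with the term in \<open>m\<close>, lets the
    induction close; \<open>cauchy\<close> then drops that term.\<close>
  have far: "sq_norm \<Omega> (\<lambda>x. U m x - U n x) \<le> 4/3 * ((1/4) ^ n - (1/4) ^ m)" if "n \<le> m" for m n
    using that
  proof (induction m rule: dec_induct)
    case base
    then show ?case
      by (simp add: sq_norm_def)
  next
    case (step m)
    have "sq_norm \<Omega> (\<lambda>x. U (Suc m) x - U n x)
        \<le> sq_norm \<Omega> (\<lambda>x. U (Suc m) x - U m x) + sq_norm \<Omega> (\<lambda>x. U m x - U n x)"
      using sq_norm_triangle_ineq[OF sq_integrable_on_diff[OF U U] sq_integrable_on_diff[OF U U],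
          of "Suc m" m m n] by simp
    then show ?case
      using step.IH \<open>\<And>n. sq_norm \<Omega> (\<lambda>x. U (Suc n) x - U n x) \<le> (1/4) ^ n\<close>[of m] by simp
  qed
  have cauchy: "sq_norm \<Omega> (\<lambda>x. U m x - U n x) \<le> 4/3 * (1/4) ^ n" if "n \<le> m" for m n
    by (rule order_trans[OF far[OF that]]) simp
  have "(\<lambda>n. 4/3 * (1/4::real) ^ n) \<longlonglongrightarrow> 4/3 * 0"
    by (intro tendsto_mult_left LIMSEQ_power_zero) simp
  then have lim: "(\<lambda>n. 4/3 * (1/4::real) ^ n) \<longlonglongrightarrow> 0"
    by simp
  obtain v where v: "v \<in> ?S" and near: "\<And>n. sq_norm \<Omega> (\<lambda>x. v x - U n x) \<le> 4/3 * (1/4) ^ n"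
    using sq_norm_complete[OF fin U cauchy lim] by blast
  obtain B where B: "\<And>n. cmod (sq_inner \<Omega> v (g n)) \<le> B * w (i n)"
    using bounded[OF v] i by (auto simp: g_def)
  obtain n where n: "6 * B < 2 ^ n"
    using real_arch_pow[of 2 "6 * B"] by auto
  have "sq_inner \<Omega> (\<lambda>x. v x - U (Suc n) x) (g n) = sq_inner \<Omega> v (g n) - sq_inner \<Omega> (U (Suc n)) (g n)"
    by (rule sq_inner_diff_left[OF v U g])
  \<comment> \<open>The distance after step \<open>n\<close> is at most 4/3 times 4^-(n+1), which is
    1/3 times 4^-n. This leaves 1/2 - 1/3 = 1/6 of the hump.\<close>
  moreover have "cmod (sq_inner \<Omega> (\<lambda>x. v x - U (Suc n) x) (g n)) \<le> 1/3 * (1/4) ^ n * sq_norm \<Omega> (g n)"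
    using near[of "Suc n"]
    by (intro order_trans[OF Cauchy_Schwarz_sq_inner[OF sq_integrable_on_diff[OF v U] g]]
        mult_right_mono) auto
  ultimately have "1/2 * (1/4) ^ n * sq_norm \<Omega> (g n) - 1/3 * (1/4) ^ n * sq_norm \<Omega> (g n)
      \<le> cmod (sq_inner \<Omega> v (g n))"
    using lower[of n] norm_triangle_ineq2[of "sq_inner \<Omega> (U (Suc n)) (g n)" "sq_inner \<Omega> v (g n)"]
    by (simp add: norm_minus_commute mult_ac)
  then have "1/6 * (1/4) ^ n * sq_norm \<Omega> (g n) \<le> B * w (i n)"
    using B[of n] by (simp add: mult_ac)
  moreover have "1/6 * (1/4) ^ n * (8 ^ n * w (i n)) < 1/6 * (1/4) ^ n * sq_norm \<Omega> (g n)"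
    using big[of n] by (simp add: g_def)
  moreover have "1/6 * (1/4) ^ n * (8 ^ n * w (i n)) = 2 ^ n / 6 * w (i n)"
    by (simp add: power_divide flip: power_mult_distrib power_divide mult.assoc)
  moreover have "B * w (i n) \<le> 2 ^ n / 6 * w (i n)"
    using n w[OF i[of n]] by (intro mult_right_mono) auto
  ultimately show False
    by simp
qed

section \<open>Riesz representation by minimization\<close>

lemma zero_if_quadratic_nonneg:
  fixes a b :: real
  assumes "\<And>t. 0 \<le> t * a + t\<^sup>2 * b"
  shows "a = 0"
proof -
  have "b \<ge> 0"
    using assms[of 1] assms[of "-1"] by simp
  \<comment> \<open>At \<open>t = -q\<close> the quadratic equals \<open>- q\<^sup>2\<close>; adding
    1 to \<open>b\<close> avoids a vanishing denominator.\<close>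
  define q where "q = a / (b + 1)"
  have a: "a = q * (b + 1)"
    using \<open>b \<ge> 0\<close> by (simp add: q_def)
  have "0 \<le> - q\<^sup>2"
    using assms[of "-q"] by (simp add: a algebra_simps power2_eq_square)
  then show ?thesis
    by (simp add: a)
qed

text \<open>If \<open>v\<close> represents \<open>l\<close>, then the squared norm of
  \<open>u\<close> minus \<open>2 * Re (l u)\<close> is the squared distance from \<open>u\<close>
  to \<open>v\<close> minus the squared norm of \<open>v\<close>. Minimizing sequences are Cauchy by
  the parallelogram law, and the first variation vanishes at their limit.\<close>

lemma sq_inner_Riesz:
  assumes fin: "finite_measure (lebesgue_on \<Omega>)"
    and add: "\<And>u v. u \<in> sq_integrable_on \<Omega> \<Longrightarrow> v \<in> sq_integrable_on \<Omega> \<Longrightarrow> l (\<lambda>x. u x + v x) = l u + l v"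
    and scale: "\<And>c u. u \<in> sq_integrable_on \<Omega> \<Longrightarrow> l (\<lambda>x. c * u x) = c * l u"
    and bound: "\<And>u. u \<in> sq_integrable_on \<Omega> \<Longrightarrow> cmod (l u) \<le> C * sq_norm \<Omega> u"
  shows "\<exists>v\<in>sq_integrable_on \<Omega>. \<forall>u\<in>sq_integrable_on \<Omega>. l u = sq_inner \<Omega> u v"
proof -
  let ?S = "sq_integrable_on \<Omega>"
  \<comment> \<open>The Riesz representer is the minimizer of this functional.\<close>
  define J where "J u = (sq_norm \<Omega> u)\<^sup>2 - 2 * Re (l u)" for u
  have "- C\<^sup>2 \<le> J u" if "u \<in> ?S" for u
  proof -
    have "0 \<le> (sq_norm \<Omega> u - C)\<^sup>2"
      by simp
    moreover have "Re (l u) \<le> C * sq_norm \<Omega> u"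
      using complex_Re_le_cmod bound[OF that] by (rule order_trans)
    ultimately show ?thesis
      by (simp add: J_def power2_diff mult.commute)
  qed
  then have bdd: "bdd_below (J ` ?S)"
    by (auto intro!: bdd_belowI2)
  define m where "m = Inf (J ` ?S)"
  have m: "m \<le> J u" if "u \<in> ?S" for u
    unfolding m_def using that bdd by (intro cInf_lower) auto
  have "\<exists>u\<in>?S. J u < m + inverse (real (Suc n))" for n
  proof -
    have "Inf (J ` ?S) < m + inverse (real (Suc n))"
      by (simp add: m_def)
    moreover have "J ` ?S \<noteq> {}"
      using sq_integrable_on_zero by blast
    ultimately show ?thesis
      using cInf_less_iff[OF _ bdd] by blast
  qed
  then obtain u where u: "\<And>n. u n \<in> ?S" and J_u: "\<And>n. J (u n) < m + inverse (real (Suc n))"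
    by metis
  \<comment> \<open>Each \<open>u n\<close> exceeds the infimum by less than
    \<open>inverse (Suc n)\<close>; the parallelogram law doubles the excess of both members, and
    the earlier index dominates.\<close>
  define e where "e n = sqrt (4 * inverse (real (Suc n)))" for n
  have cauchy: "sq_norm \<Omega> (\<lambda>x. u a x - u b x) \<le> e b" if "b \<le> a" for a b
  proof -
    have sum: "(\<lambda>x. u a x + u b x) \<in> ?S"
      by (intro sq_integrable_on_add u)
    \<comment> \<open>The midpoint is a competitor, so the norm of the sum cannot be small; the
      parallelogram law then makes the norm of the difference small.\<close>
    have "m \<le> J (\<lambda>x. 1/2 * (u a x + u b x))"
      by (intro m sq_integrable_on_scale sum)
    also have "\<dots> = (sq_norm \<Omega> (\<lambda>x. u a x + u b x))\<^sup>2 / 4 - Re (l (u a)) - Re (l (u b))"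
      unfolding J_def sq_norm_scale scale[OF sum] add[OF u u]
      by (simp add: power_divide norm_divide field_simps)
    finally have "(sq_norm \<Omega> (\<lambda>x. u a x - u b x))\<^sup>2 \<le> 2 * J (u a) + 2 * J (u b) - 4 * m"
      by (simp add: sq_norm_parallelogram[OF u u] J_def)
    also have "\<dots> \<le> 2 * inverse (real (Suc a)) + 2 * inverse (real (Suc b))"
      using J_u[of a] J_u[of b] by simp
    also have "\<dots> \<le> 4 * inverse (real (Suc b))"
      using le_imp_inverse_le[of "real (Suc b)" "real (Suc a)"] that by simp
    finally show ?thesis
      unfolding e_def by (rule real_le_rsqrt)
  qed
  have "(\<lambda>n. sqrt (4 * inverse (real (Suc n)))) \<longlonglongrightarrow> sqrt (4 * 0)"
    by (intro tendsto_intros LIMSEQ_inverse_real_of_nat)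
  then have e: "e \<longlonglongrightarrow> 0"
    by (simp add: e_def[abs_def])
  obtain v where v: "v \<in> ?S" and near: "\<And>n. sq_norm \<Omega> (\<lambda>x. v x - u n x) \<le> e n"
    using sq_norm_complete[OF fin u cauchy e] by blast
  have "(\<lambda>n. sq_norm \<Omega> (u n)) \<longlonglongrightarrow> sq_norm \<Omega> v"
  proof (rule LIM_zero_cancel, rule Lim_null_comparison[OF _ e])
    show "\<forall>\<^sub>F n in sequentially. norm (sq_norm \<Omega> (u n) - sq_norm \<Omega> v) \<le> e n"
      using order_trans[OF sq_norm_triangle_ineq3[OF v u] near] by (simp add: abs_minus_commute)
  qed
  moreover have "(\<lambda>n. l (u n)) \<longlonglongrightarrow> l v"
  proof (rule LIM_zero_cancel, rule Lim_null_comparison)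
    have "norm (l (u n) - l v) \<le> \<bar>C\<bar> * e n" for n
    proof -
      have "l (\<lambda>x. u n x - v x) = l (u n) - l v"
        using add[OF u sq_integrable_on_scale[OF v], of n "-1"] scale[OF v, of "-1"] by simp
      then have "norm (l (u n) - l v) \<le> C * sq_norm \<Omega> (\<lambda>x. u n x - v x)"
        using bound[OF sq_integrable_on_diff[OF u v], of n] by simp
      also have "\<dots> \<le> \<bar>C\<bar> * e n"
        using near[of n] by (intro mult_mono) (auto simp: sq_norm_minus_commute[of \<Omega> v])
      finally show ?thesis .
    qed
    then show "\<forall>\<^sub>F n in sequentially. norm (l (u n) - l v) \<le> \<bar>C\<bar> * e n"
      by simp
    show "(\<lambda>n. \<bar>C\<bar> * e n) \<longlonglongrightarrow> 0"
      using tendsto_mult_left[OF e] by simp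
  qed
  ultimately have "(\<lambda>n. J (u n)) \<longlonglongrightarrow> J v"
    unfolding J_def by (intro tendsto_intros)
  moreover have "(\<lambda>n. m + inverse (real (Suc n))) \<longlonglongrightarrow> m + 0"
    by (intro tendsto_intros LIMSEQ_inverse_real_of_nat)
  ultimately have "J v \<le> m + 0"
    using J_u by (intro LIMSEQ_le) (auto intro: less_imp_le)
  then have minimal: "J v \<le> J w" if "w \<in> ?S" for w
    using m[OF that] by simp
  have Re_eq: "Re (l w) = Re (sq_inner \<Omega> w v)" if w: "w \<in> ?S" for w
  proof -
    have "0 \<le> t * (2 * (Re (sq_inner \<Omega> w v) - Re (l w))) + t\<^sup>2 * (sq_norm \<Omega> w)\<^sup>2" for t
    proof -
      have "J v \<le> J (\<lambda>x. v x + of_real t * w x)"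
        by (intro minimal sq_integrable_on_add sq_integrable_on_scale v w)
      also have "\<dots> = J v + t * (2 * (Re (sq_inner \<Omega> w v) - Re (l w))) + t\<^sup>2 * (sq_norm \<Omega> w)\<^sup>2"
        unfolding J_def sq_norm_add_scaled_square[OF v w] add[OF v sq_integrable_on_scale[OF w]] scale[OF w]
        by (simp add: algebra_simps)
      finally show ?thesis
        by simp
    qed
    then show ?thesis
      using zero_if_quadratic_nonneg by fastforce
  qed
  have "l w = sq_inner \<Omega> w v" if w: "w \<in> ?S" for w
  proof (rule complex_eqI)
    \<comment> \<open>Multiplying the argument by the imaginary unit turns imaginary parts into
      negated real parts.\<close>
    show "Im (l w) = Im (sq_inner \<Omega> w v)"
      using Re_eq[OF sq_integrable_on_scale[OF w], of \<i>] by (simp add: scale[OF w] sq_inner_scale_left)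
  qed (rule Re_eq[OF w])
  with v show ?thesis
    by blast
qed

section \<open>Symmetric operators with continuous range\<close>

text \<open>The operator moved from classes to functions, with \<open>A u\<close> the continuous
  representative. Linearity is demanded only on the closure, because representatives are arbitrary
  elsewhere.\<close>

locale continuous_range_operator =
  fixes \<Omega> :: "'a::euclidean_space set" and A :: "('a \<Rightarrow> complex) \<Rightarrow> 'a \<Rightarrow> complex"
  assumes open_domain: "open \<Omega>" and bounded_domain: "bounded \<Omega>"
    and range: "u \<in> sq_integrable_on \<Omega> \<Longrightarrow> A u \<in> sq_integrable_on \<Omega>"
    and continuous: "u \<in> sq_integrable_on \<Omega> \<Longrightarrow> continuous_on (closure \<Omega>) (A u)"
    and add: "u \<in> sq_integrable_on \<Omega> \<Longrightarrow> v \<in> sq_integrable_on \<Omega> \<Longrightarrow> x \<in> closure \<Omega> \<Longrightarrow>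
      A (\<lambda>y. u y + v y) x = A u x + A v x"
    and scale: "u \<in> sq_integrable_on \<Omega> \<Longrightarrow> x \<in> closure \<Omega> \<Longrightarrow> A (\<lambda>y. c * u y) x = c * A u x"
    and symmetric: "u \<in> sq_integrable_on \<Omega> \<Longrightarrow> v \<in> sq_integrable_on \<Omega> \<Longrightarrow>
      sq_inner \<Omega> (A u) v = sq_inner \<Omega> u (A v)"
begin

lemma finite_measure_domain: "finite_measure (lebesgue_on \<Omega>)"
proof
  have "\<Omega> \<in> lmeasurable"
    using bounded_domain open_domain by (rule lmeasurable_open)
  then show "emeasure (lebesgue_on \<Omega>) (space (lebesgue_on \<Omega>)) \<noteq> \<infinity>"
    using fmeasurableD2[of \<Omega> lebesgue] by (simp add: emeasure_restrict_space fmeasurableD)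
qed

text \<open>
  By symmetry, the elements \<open>A v\<close> with \<open>v\<close> of unit \<open>L\<^sup>1\<close> norm form a weakly bounded family, hence
  a bounded one; dually, \<open>A\<close> maps \<open>L\<^sup>2\<close> boundedly into \<open>L\<^sup>\<infinity>\<close>.
\<close>
lemma sup_bound:
  obtains C where "C \<ge> 0"
    "\<And>u x. u \<in> sq_integrable_on \<Omega> \<Longrightarrow> x \<in> closure \<Omega> \<Longrightarrow> cmod (A u x) \<le> C * sq_norm \<Omega> u"
proof -
  let ?S = "sq_integrable_on \<Omega>" and ?M = "lebesgue_on \<Omega>"
  note fin = finite_measure_domain
  have "\<exists>C. \<forall>v\<in>?S. sq_norm \<Omega> (A v) \<le> C * (LINT x|?M. cmod (v x))"
  proof (rule sq_norm_uniformly_bounded[OF fin range])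
    fix u
    assume u: "u \<in> ?S"
    \<comment> \<open>Weak boundedness: \<open>A u\<close> is bounded on the compact closure, and
      symmetry moves \<open>A\<close> from \<open>v\<close> to \<open>u\<close>.\<close>
    have "compact (A u ` closure \<Omega>)"
      using continuous[OF u] bounded_domain by (intro compact_continuous_image) simp_all
    then have "bounded (A u ` closure \<Omega>)"
      by (rule compact_imp_bounded)
    then obtain B where B: "\<And>x. x \<in> closure \<Omega> \<Longrightarrow> cmod (A u x) \<le> B"
      by (auto simp: bounded_iff)
    have "cmod (sq_inner \<Omega> u (A v)) \<le> B * (LINT x|?M. cmod (v x))" if v: "v \<in> ?S" for v
    proof -
      have "cmod (sq_inner \<Omega> (A u) v) \<le> (LINT x|?M. B * cmod (v x))"
        unfolding sq_inner_def
      proof (rule Bochner_Integration.integral_norm_bound_integral)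
        show "integrable ?M (\<lambda>x. A u x * cnj (v x))"
          by (rule sq_integrable_on_integrable_mult_cnj[OF range[OF u] v])
        show "integrable ?M (\<lambda>x. B * cmod (v x))"
          by (intro integrable_mult_right sq_integrable_on_integrable_norm[OF fin v])
        show "cmod (A u x * cnj (v x)) \<le> B * cmod (v x)" if "x \<in> space ?M" for x
          using that B[of x] closure_subset by (auto simp: norm_mult intro!: mult_right_mono)
      qed
      then show ?thesis
        by (simp add: symmetric[OF u v])
    qed
    then show "\<exists>B. \<forall>v\<in>?S. cmod (sq_inner \<Omega> u (A v)) \<le> B * (LINT x|?M. cmod (v x))"
      by blast
  qed auto
  then obtain C' where C': "\<And>v. v \<in> ?S \<Longrightarrow> sq_norm \<Omega> (A v) \<le> C' * (LINT x|?M. cmod (v x))"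
    by blast
  define C where "C = max C' 0"
  have "C \<ge> 0"
    by (simp add: C_def)
  have C: "sq_norm \<Omega> (A v) \<le> C * (LINT x|?M. cmod (v x))" if "v \<in> ?S" for v
    by (rule order_trans[OF C'[OF that]]) (auto simp: C_def intro!: mult_right_mono)
  have "cmod (A u x) \<le> C * sq_norm \<Omega> u" if u: "u \<in> ?S" and x: "x \<in> closure \<Omega>" for u x
  proof -
    define c where "c = C * sq_norm \<Omega> u"
    have "c \<ge> 0"
      using \<open>C \<ge> 0\<close> by (simp add: c_def)
    note [measurable] = sq_integrable_on_measurable[OF range[OF u]]
    \<comment> \<open>tests \<open>A u\<close> exactly where it exceeds the claimed bound\<close>
    define v where "v y = (if c < cmod (A u y) then A u y / of_real (cmod (A u y)) else 0)" for y
    have [measurable]: "v \<in> borel_measurable ?M"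
      unfolding v_def[abs_def] by measurable
    have v: "v \<in> ?S"
      by (rule sq_integrable_on_bounded[OF fin, of _ 1]) (auto simp: v_def norm_divide)
    \<comment> \<open>The excess of the modulus of \<open>A u\<close> over \<open>c\<close>. Since
      \<open>v\<close> carries the phase of \<open>A u\<close> where the excess is positive, the
      integral of \<open>f\<close> is the pairing of \<open>A u\<close> with \<open>v\<close> minus
      \<open>c\<close> times the \<open>L\<^sup>1\<close> norm of \<open>v\<close>. By symmetry,
      Cauchy-Schwarz and the choice of \<open>c\<close> it is at most 0.\<close>
    define f where "f y = max 0 (cmod (A u y) - c)" for y
    have f: "of_real (f y) = A u y * cnj (v y) - of_real (c * cmod (v y))" for y
    proof (cases "c < cmod (A u y)")
      case True
      with \<open>c \<ge> 0\<close> have "A u y \<noteq> 0"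
        by auto
      then have "A u y * cnj (v y) = of_real (cmod (A u y))"
        using True by (simp add: v_def complex_norm_square[symmetric] power2_eq_square)
      moreover have "cmod (v y) = 1"
        using True \<open>A u y \<noteq> 0\<close> by (simp add: v_def norm_divide)
      ultimately show ?thesis
        using True by (simp add: f_def)
    qed (simp add: f_def v_def)
    have int: "integrable ?M (\<lambda>y. A u y * cnj (v y))" "integrable ?M (\<lambda>y. cmod (v y))"
      using sq_integrable_on_integrable_mult_cnj[OF range[OF u] v]
        sq_integrable_on_integrable_norm[OF fin v] .
    have "integrable ?M (\<lambda>y. complex_of_real (f y))"
      unfolding f using int by simp
    from integrable_Re[OF this] have int_f: "integrable ?M f"
      by simp
    have "complex_of_real (integral\<^sup>L ?M f) = (LINT y|?M. A u y * cnj (v y) - of_real (c * cmod (v y)))"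
      unfolding f[symmetric] by simp
    also have "\<dots> = sq_inner \<Omega> u (A v) - of_real (c * (LINT y|?M. cmod (v y)))"
      unfolding symmetric[OF u v, symmetric] using int by (simp add: sq_inner_def)
    finally have "integral\<^sup>L ?M f = Re (sq_inner \<Omega> u (A v)) - c * (LINT y|?M. cmod (v y))"
      by (metis Re_complex_of_real minus_complex.sel(1))
    also have "Re (sq_inner \<Omega> u (A v)) \<le> sq_norm \<Omega> u * sq_norm \<Omega> (A v)"
      using complex_Re_le_cmod Cauchy_Schwarz_sq_inner[OF u range[OF v]] by (rule order_trans)
    also have "\<dots> \<le> sq_norm \<Omega> u * (C * (LINT y|?M. cmod (v y)))"
      by (intro mult_left_mono C v) simp
    finally have "integral\<^sup>L ?M f \<le> 0"
      by (simp add: c_def mult_ac)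
    moreover have "integral\<^sup>L ?M f \<ge> 0"
      by (simp add: f_def)
    ultimately have "AE y in ?M. f y = 0"
      using integral_nonneg_eq_0_iff_AE[OF int_f] by (simp add: f_def)
    then have AE: "AE y in ?M. complex_of_real (f y) = 0"
      by simp
    \<comment> \<open>Continuity upgrades the vanishing of \<open>f\<close> almost everywhere to
      every point of the closure, boundary included.\<close>
    have "continuous_on (closure \<Omega>) (\<lambda>y. complex_of_real (f y))"
      unfolding f_def by (intro continuous_intros continuous[OF u])
    from continuous_rep_unique[OF open_domain this continuous_on_const AE x]
    show ?thesis
      by (simp add: f_def c_def)
  qed
  with \<open>C \<ge> 0\<close> show thesis
    by (rule that)
qed

text \<open>Point evaluations of \<open>A u\<close> are bounded functionals by
  \<open>sup_bound\<close>, with one constant for all points, so Riesz applies. Testing with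
  \<open>k x\<close> itself bounds its norm, as \<open>A (k x) x\<close> is the squared norm of
  \<open>k x\<close>.\<close>

lemma exists_representers:
  obtains k C where "\<And>x. x \<in> closure \<Omega> \<Longrightarrow> k x \<in> sq_integrable_on \<Omega>"
    "\<And>x u. x \<in> closure \<Omega> \<Longrightarrow> u \<in> sq_integrable_on \<Omega> \<Longrightarrow> A u x = sq_inner \<Omega> u (k x)"
    "\<And>x. x \<in> closure \<Omega> \<Longrightarrow> sq_norm \<Omega> (k x) \<le> C"
    "\<And>x y. x \<in> closure \<Omega> \<Longrightarrow> y \<in> closure \<Omega> \<Longrightarrow> cmod (A (k x) y) \<le> C\<^sup>2"
proof -
  let ?S = "sq_integrable_on \<Omega>"
  obtain C where "C \<ge> 0"
    and C: "\<And>u x. u \<in> ?S \<Longrightarrow> x \<in> closure \<Omega> \<Longrightarrow> cmod (A u x) \<le> C * sq_norm \<Omega> u"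
    using sup_bound by blast
  have "\<exists>v\<in>?S. \<forall>u\<in>?S. A u x = sq_inner \<Omega> u v" if x: "x \<in> closure \<Omega>" for x
    by (rule sq_inner_Riesz[OF finite_measure_domain, where C = C])
      (use x in \<open>auto intro: add scale C\<close>)
  then obtain k where k: "\<And>x. x \<in> closure \<Omega> \<Longrightarrow> k x \<in> ?S"
    and repr: "\<And>x u. x \<in> closure \<Omega> \<Longrightarrow> u \<in> ?S \<Longrightarrow> A u x = sq_inner \<Omega> u (k x)"
    by metis
  have norm_k: "sq_norm \<Omega> (k x) \<le> C" if x: "x \<in> closure \<Omega>" for x
  proof -
    have "cmod (sq_inner \<Omega> (k x) (k x)) \<le> C * sq_norm \<Omega> (k x)"
      using C[OF k x] x by (simp add: repr[OF x k])
    then have "sq_norm \<Omega> (k x) * sq_norm \<Omega> (k x) \<le> C * sq_norm \<Omega> (k x)"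
      by (simp add: sq_inner_self norm_power power2_eq_square norm_mult)
    then show ?thesis
      using \<open>C \<ge> 0\<close> sq_norm_nonneg[of \<Omega> "k x"] by (cases "sq_norm \<Omega> (k x) = 0") auto
  qed
  have "cmod (A (k x) y) \<le> C\<^sup>2" if "x \<in> closure \<Omega>" "y \<in> closure \<Omega>" for x y
    using order_trans[OF C[OF k[OF that(1)] that(2)] mult_left_mono[OF norm_k[OF that(1)] \<open>C \<ge> 0\<close>]]
    by (simp add: power2_eq_square)
  with k repr norm_k show thesis
    by (rule that)
qed

section \<open>The continuous kernel of the cube\<close>

theorem cube_has_continuous_kernel:
  "\<exists>K. continuous_on (closure \<Omega> \<times> closure \<Omega>) K \<and>
    (\<forall>u\<in>sq_integrable_on \<Omega>. \<forall>x\<in>closure \<Omega>.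
      A (A (A u)) x = (LINT y|lebesgue_on \<Omega>. K (x, y) * u y))"
proof -
  let ?S = "sq_integrable_on \<Omega>" and ?M = "lebesgue_on \<Omega>"
  obtain k C where k: "\<And>x. x \<in> closure \<Omega> \<Longrightarrow> k x \<in> ?S"
    and repr: "\<And>x u. x \<in> closure \<Omega> \<Longrightarrow> u \<in> ?S \<Longrightarrow> A u x = sq_inner \<Omega> u (k x)"
    and norm_k: "\<And>x. x \<in> closure \<Omega> \<Longrightarrow> sq_norm \<Omega> (k x) \<le> C"
    and bound: "\<And>x y. x \<in> closure \<Omega> \<Longrightarrow> y \<in> closure \<Omega> \<Longrightarrow> cmod (A (k x) y) \<le> C\<^sup>2"
    using exists_representers by metis
  have in_closure: "y \<in> closure \<Omega>" if "y \<in> \<Omega>" for y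
    using that closure_subset by auto
  \<comment> \<open>This exchanges the parameter of \<open>k\<close> with the evaluation point, so
    continuity of \<open>A (k z)\<close> becomes pointwise convergence of \<open>A (k (X n))\<close>
    at \<open>z\<close>.\<close>
  have hermitian: "A (k x) y = cnj (A (k y) x)" if "x \<in> closure \<Omega>" "y \<in> closure \<Omega>" for x y
    using that by (simp add: repr k sq_inner_cnj)
  have strong: "(\<lambda>n. sq_norm \<Omega> (\<lambda>z. A (k (X n)) z - A (k x) z)) \<longlonglongrightarrow> 0"
    if X: "\<And>n. X n \<in> closure \<Omega>" "x \<in> closure \<Omega>" "X \<longlonglongrightarrow> x" for X x
  proof -
    have pointwise: "(\<lambda>n. A (k (X n)) z) \<longlonglongrightarrow> A (k x) z" if z: "z \<in> closure \<Omega>" for z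
    proof -
      have "(\<lambda>n. A (k z) (X n)) \<longlonglongrightarrow> A (k z) x"
        by (rule continuous_on_tendsto_compose[OF continuous[OF k[OF z]] X(3,2)]) (simp add: X)
      then have "(\<lambda>n. cnj (A (k z) (X n))) \<longlonglongrightarrow> cnj (A (k z) x)"
        by (rule tendsto_cnj)
      then show ?thesis
        using X z by (simp add: hermitian[symmetric])
    qed
    have "(\<lambda>n. LINT z|?M. (cmod (A (k (X n)) z - A (k x) z))\<^sup>2) \<longlonglongrightarrow> (LINT z|?M. 0)"
    proof (rule integral_dominated_convergence)
      show "integrable ?M (\<lambda>z. (2 * C\<^sup>2)\<^sup>2)"
        by (rule finite_measure.integrable_const[OF finite_measure_domain])
      show "(\<lambda>z. (cmod (A (k (X n)) z - A (k x) z))\<^sup>2) \<in> borel_measurable ?M" for n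
        by (intro borel_measurable_integrable sq_integrable_on_integrable_square
            sq_integrable_on_diff range k X)
      show "AE z in ?M. (\<lambda>n. (cmod (A (k (X n)) z - A (k x) z))\<^sup>2) \<longlonglongrightarrow> 0"
      proof (rule AE_I2)
        fix z
        assume "z \<in> space ?M"
        then have "(\<lambda>n. (cmod (A (k (X n)) z - A (k x) z))\<^sup>2) \<longlonglongrightarrow> (cmod (A (k x) z - A (k x) z))\<^sup>2"
          by (intro tendsto_intros pointwise) (auto intro: in_closure)
        then show "(\<lambda>n. (cmod (A (k (X n)) z - A (k x) z))\<^sup>2) \<longlonglongrightarrow> 0"
          by simp
      qed
      show "AE z in ?M. norm ((cmod (A (k (X n)) z - A (k x) z))\<^sup>2) \<le> (2 * C\<^sup>2)\<^sup>2" for n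
      proof (rule AE_I2)
        fix z
        assume "z \<in> space ?M"
        then have "z \<in> closure \<Omega>"
          by (auto intro: in_closure)
        then have "cmod (A (k (X n)) z - A (k x) z) \<le> C\<^sup>2 + C\<^sup>2"
          by (intro order_trans[OF norm_triangle_ineq4] add_mono bound X)
        then show "norm ((cmod (A (k (X n)) z - A (k x) z))\<^sup>2) \<le> (2 * C\<^sup>2)\<^sup>2"
          using power_mono[OF _ norm_ge_zero, of "A (k (X n)) z - A (k x) z" "C\<^sup>2 + C\<^sup>2" 2] by simp
      qed
    qed simp
    then have "(\<lambda>n. sqrt (LINT z|?M. (cmod (A (k (X n)) z - A (k x) z))\<^sup>2)) \<longlonglongrightarrow> sqrt 0"
      by (intro tendsto_real_sqrt) simp
    then show ?thesis
      by (simp add: sq_norm_def)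
  qed
  \<comment> \<open>Evaluation at \<open>x\<close> is pairing with \<open>k x\<close>; moving the
    two remaining factors \<open>A\<close> onto \<open>k x\<close> leaves the pairing of
    \<open>u\<close> with \<open>A (A (k x))\<close>, whose conjugate is the kernel.\<close>
  define K where "K = (\<lambda>(x, y). cnj (A (A (k x)) y))"
  have "continuous_on (closure \<Omega> \<times> closure \<Omega>) K"
  proof (rule continuous_on_sequentiallyI)
    fix Z z
    assume Z: "\<forall>n. Z n \<in> closure \<Omega> \<times> closure \<Omega>" "z \<in> closure \<Omega> \<times> closure \<Omega>" "Z \<longlonglongrightarrow> z"
    define X Y x y where "X n = fst (Z n)" and "Y n = snd (Z n)" and "x = fst z" and "y = snd z" for n
    have X: "X n \<in> closure \<Omega>" and Y: "Y n \<in> closure \<Omega>" for n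
      using Z(1) by (auto simp: X_def Y_def mem_Times_iff)
    have x: "x \<in> closure \<Omega>" and y: "y \<in> closure \<Omega>"
      using Z(2) by (auto simp: x_def y_def mem_Times_iff)
    have lim: "X \<longlonglongrightarrow> x" "Y \<longlonglongrightarrow> y"
      unfolding X_def Y_def x_def y_def using Z(3) by (auto intro: tendsto_fst tendsto_snd)
    \<comment> \<open>The increment is split. Changing \<open>x\<close> is controlled uniformly in
      the evaluation point, as \<open>k (Y n)\<close> has norm at most \<open>C\<close>; changing
      the evaluation point for fixed \<open>x\<close> uses continuity of
      \<open>A (A (k x))\<close>.\<close>
    have "(\<lambda>n. A (A (k (X n))) (Y n) - A (A (k x)) (Y n)) \<longlonglongrightarrow> 0"
    proof (rule Lim_null_comparison)
      have "norm (A (A (k (X n))) (Y n) - A (A (k x)) (Y n))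
          \<le> sq_norm \<Omega> (\<lambda>z. A (k (X n)) z - A (k x) z) * C" for n
      proof -
        have "A (A (k (X n))) (Y n) - A (A (k x)) (Y n)
            = sq_inner \<Omega> (\<lambda>z. A (k (X n)) z - A (k x) z) (k (Y n))"
          by (simp add: repr k range sq_inner_diff_left X Y x)
        also have "cmod \<dots> \<le> sq_norm \<Omega> (\<lambda>z. A (k (X n)) z - A (k x) z) * sq_norm \<Omega> (k (Y n))"
          by (intro Cauchy_Schwarz_sq_inner sq_integrable_on_diff range k X Y x)
        also have "\<dots> \<le> sq_norm \<Omega> (\<lambda>z. A (k (X n)) z - A (k x) z) * C"
          by (intro mult_left_mono norm_k Y) simp
        finally show ?thesis .
      qed
      then show "\<forall>\<^sub>F n in sequentially. norm (A (A (k (X n))) (Y n) - A (A (k x)) (Y n))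
          \<le> sq_norm \<Omega> (\<lambda>z. A (k (X n)) z - A (k x) z) * C"
        by simp
      show "(\<lambda>n. sq_norm \<Omega> (\<lambda>z. A (k (X n)) z - A (k x) z) * C) \<longlonglongrightarrow> 0"
        by (rule tendsto_mult_left_zero[OF strong[OF X x lim(1)]])
    qed
    moreover have "(\<lambda>n. A (A (k x)) (Y n)) \<longlonglongrightarrow> A (A (k x)) y"
      by (rule continuous_on_tendsto_compose[OF continuous[OF range[OF k[OF x]]] lim(2) y]) (simp add: Y)
    ultimately have "(\<lambda>n. A (A (k (X n))) (Y n) - A (A (k x)) (Y n) + A (A (k x)) (Y n))
        \<longlonglongrightarrow> 0 + A (A (k x)) y"
      by (rule tendsto_add)
    then have "(\<lambda>n. cnj (A (A (k (X n))) (Y n))) \<longlonglongrightarrow> cnj (A (A (k x)) y)"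
      by (intro tendsto_cnj) simp
    then show "(\<lambda>n. K (Z n)) \<longlonglongrightarrow> K z"
      by (simp add: K_def case_prod_beta X_def Y_def x_def y_def)
  qed
  moreover have "A (A (A u)) x = (LINT y|?M. K (x, y) * u y)" if "u \<in> ?S" "x \<in> closure \<Omega>" for u x
  proof -
    have "A (A (A u)) x = sq_inner \<Omega> u (A (A (k x)))"
      using that by (simp add: repr k range symmetric)
    then show ?thesis
      by (simp add: sq_inner_def K_def mult.commute)
  qed
  ultimately show ?thesis
    by blast
qed

end

section \<open>Transfer to operators on classes\<close>

theorem theorem1p1:
  fixes \<Omega> :: "(real ^ 'd) set"
    and T :: "(real ^ 'd) L2_class \<Rightarrow> (real ^ 'd) L2_class"
  assumes "open \<Omega>" and "bounded \<Omega>"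
    and "L2_bounded_operator \<Omega> T"
    and "L2_self_adjoint \<Omega> T"
    and "\<forall>f\<in>L2 \<Omega>. has_continuous_rep \<Omega> (T f)"
  shows "\<exists>K :: (real ^ 'd) \<times> (real ^ 'd) \<Rightarrow> complex.
           continuous_on (closure \<Omega> \<times> closure \<Omega>) K \<and>
           (\<forall>u\<in>sq_integrable_on \<Omega>. \<forall>x\<in>closure \<Omega>.
              continuous_rep_value \<Omega> ((T ^^ 3) (L2_class_of \<Omega> u)) x =
                (LINT y|lebesgue_on \<Omega>. K (x, y) * u y))"
proof -
  let ?S = "sq_integrable_on \<Omega>" and ?c = "L2_class_of \<Omega>"
  have T_L2: "T f \<in> L2 \<Omega>" if "f \<in> L2 \<Omega>" for f
    using assms(3) that by (simp add: L2_bounded_operator_def)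
  define A where "A u = (SOME g. g \<in> T (?c u) \<and> continuous_on (closure \<Omega>) g)" for u
  have A: "A u \<in> T (?c u)" "continuous_on (closure \<Omega>) (A u)" if "u \<in> ?S" for u
  proof -
    have "\<exists>g. g \<in> T (?c u) \<and> continuous_on (closure \<Omega>) g"
      using assms(5) L2_class_of_in_L2[OF that] by (auto simp: has_continuous_rep_def)
    from someI_ex[OF this] show "A u \<in> T (?c u)" "continuous_on (closure \<Omega>) (A u)"
      by (simp_all add: A_def)
  qed
  have class_of_member: "v \<in> ?S \<and> ?c v = f" if "f \<in> L2 \<Omega>" "v \<in> f" for f v
  proof -
    obtain w where w: "w \<in> ?S" "f = ?c w"
      using \<open>f \<in> L2 \<Omega>\<close> by (rule L2_cases)
    with \<open>v \<in> f\<close> show ?thesis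
      using L2_class_of_eq_iff[of w \<Omega> v] by (simp add: mem_L2_class_of_iff)
  qed
  have A_S: "A u \<in> ?S" and c_A: "?c (A u) = T (?c u)" if "u \<in> ?S" for u
    using class_of_member[OF T_L2[OF L2_class_of_in_L2[OF that]] A(1)[OF that]] by auto
  \<comment> \<open>Converts identities between classes, such as linearity of \<open>T\<close>, into
    the pointwise laws on the closure that the locale asks for.\<close>
  have unique: "g x = h x" if "g \<in> ?S" "h \<in> ?S" "?c g = ?c h" "continuous_on (closure \<Omega>) g"
    "continuous_on (closure \<Omega>) h" "x \<in> closure \<Omega>" for g h x
    using continuous_rep_unique[OF assms(1) that(4,5) _ that(6)] L2_class_of_eq_iff[OF that(1,2)] that(3)
    by simp
  interpret continuous_range_operator \<Omega> A
  proof
    show "A (\<lambda>y. u y + v y) x = A u x + A v x" if "u \<in> ?S" "v \<in> ?S" "x \<in> closure \<Omega>" for u v x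
    proof (rule unique)
      have "?c (A (\<lambda>y. u y + v y)) = T (L2_add \<Omega> (?c u) (?c v))"
        using that by (simp add: c_A sq_integrable_on_add L2_add_class_of)
      also have "\<dots> = L2_add \<Omega> (?c (A u)) (?c (A v))"
        using assms(3) that by (simp add: L2_bounded_operator_def L2_class_of_in_L2 c_A)
      also have "\<dots> = ?c (\<lambda>y. A u y + A v y)"
        using that by (simp add: L2_add_class_of A_S)
      finally show "?c (A (\<lambda>y. u y + v y)) = ?c (\<lambda>y. A u y + A v y)" .
    qed (use that in \<open>simp_all add: A A_S sq_integrable_on_add continuous_on_add\<close>)
    show "A (\<lambda>y. c * u y) x = c * A u x" if "u \<in> ?S" "x \<in> closure \<Omega>" for u x c
    proof (rule unique)
      have "?c (A (\<lambda>y. c * u y)) = T (L2_scale \<Omega> c (?c u))"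
        using that by (simp add: c_A sq_integrable_on_scale L2_scale_class_of)
      also have "\<dots> = L2_scale \<Omega> c (?c (A u))"
        using assms(3) that by (simp add: L2_bounded_operator_def L2_class_of_in_L2 c_A)
      also have "\<dots> = ?c (\<lambda>y. c * A u y)"
        using that by (simp add: L2_scale_class_of A_S)
      finally show "?c (A (\<lambda>y. c * u y)) = ?c (\<lambda>y. c * A u y)" .
    qed (use that in \<open>simp_all add: A A_S sq_integrable_on_scale continuous_on_mult_left\<close>)
    show "sq_inner \<Omega> (A u) v = sq_inner \<Omega> u (A v)" if "u \<in> ?S" "v \<in> ?S" for u v
    proof -
      have "L2_inner \<Omega> (?c (A u)) (?c v) = L2_inner \<Omega> (?c u) (?c (A v))"
        using assms(4) that by (simp add: L2_self_adjoint_def c_A L2_class_of_in_L2)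
      then show ?thesis
        using that by (simp add: L2_inner_class_of A_S sq_inner_def)
    qed
  qed (use assms(1,2) A A_S in auto)
  have "continuous_rep_value \<Omega> ((T ^^ 3) (?c u)) x = A (A (A u)) x" if "u \<in> ?S" "x \<in> closure \<Omega>" for u x
  proof -
    have "(T ^^ 3) (?c u) = T (?c (A (A u)))"
      using that by (simp add: numeral_3_eq_3 c_A A_S)
    then show ?thesis
      using that by (simp add: continuous_rep_value_eq[OF assms(1)] A A_S T_L2 L2_class_of_in_L2)
  qed
  with cube_has_continuous_kernel show ?thesis
    by auto
qed

end
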